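(* Consider $\dot x=f(x)+g(x)u$ on $\mathbb{R}^n$ with $f:\mathbb{R}^n\to\mathbb{R}^n$, $g:\mathbb{R}^n\to\mathbb{R}^{n\times m}$ locally Lipschitz and $f(0)=0$. Let $\mathcal{D}\subseteq\mathbb{R}^n$ be open, $\mathcal{C}\subset\mathcal{D}$ closed with $0\in\mathcal{C}$, $V$ a CLF on $\mathcal{D}$ (with associated function $W$) and $h$ a CBF of $\mathcal{C}$ (with associated function $\alpha$). For $\epsilon>0$ let $u_\epsilon^{\mathrm{safe}}$ be the safety QP with stability penalty controller and let $e(x)=-L_fh(x)+\frac1\epsilon L_gh(x)^TL_gV(x)-\alpha(h(x))$ (see context). For $\epsilon>0$, the set of equilibrium points in $\mathcal{C}$ of the closed-loop system $\dot x=f(x)+g(x)u_\epsilon^{\mathrm{safe}}(x)$ is $\mathcal{Q}=\mathcal{Q}_1^\epsilon\cup\mathcal{Q}_2^\epsilon$, where $$\mathcal{Q}_1^\epsilon:=\Big\{x\in\mathcal{C}: e(x)\le 0,\ f(x)=\tfrac1\epsilon g(x)L_gV(x)\Big\},$$ $$\mathcal{Q}_2^\epsilon:=\Big\{x\in\partial\mathcal{C}: e(x)>0,\ f(x)=\tfrac{L_fh(x)}{\|L_gh(x)\|^2}g(x)L_gh(x)+\tfrac{g(x)}{\epsilon}\Big(L_gV(x)-\tfrac{L_gh(x)^TL_gV(x)}{\|L_gh(x)\|^2}L_gh(x)\Big)\Big\},$$ and $0\in\mathcal{Q}_1^\epsilon$. Let $\mathcal{V}$ be a neighborhood of the origin,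 let $\bar{\mathcal{V}}$ be a neighborhood of $P_g:=\{x\in\mathcal{C}\setminus\{0\}: L_gV(x)=0\}$, and define $$N_1:=\sup_{x\in\mathcal{C}}\|f(x)\|,\qquad N_2:=\sup_{x\in\partial\mathcal{C},\ e(x)>0}\Big\|f(x)-\tfrac{L_fh(x)}{\|L_gh(x)\|^2}g(x)L_gh(x)\Big\|,$$ $$N_3^{\mathcal{V},\bar{\mathcal{V}}}:=\inf_{x\in\mathcal{C}\setminus(\mathcal{V}\cup\bar{\mathcal{V}})}\|g(x)L_gV(x)\|,\qquad N_4:=\inf_{x\in\partial\mathcal{C},\ e(x)>0}\Big\|g(x)\Big(L_gV(x)-\tfrac{L_gh(x)^TL_gV(x)}{\|L_gh(x)\|^2}L_gh(x)\Big)\Big\|.$$ Then: (i) if $N_1$ is finite, then $\mathcal{Q}_1^\epsilon\subseteq\mathcal{V}$ for all $0<\epsilon<\frac{N_3^{\mathcal{V},\bar{\mathcal{V}}}}{N_1}$; (ii) if $N_2$ is finite and $N_4$ is positive, then $\mathcal{Q}_2^\epsilon=\emptyset$ for $0<\epsilon<\frac{N_4}{N_2}$.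
   Context: For smooth $F:\mathbb{R}^n\to\mathbb{R}$, $L_fF=\nabla F^Tf\in\mathbb{R}$, and $L_gF$ is the Lie derivative along $g$, regarded as the column vector $g^T\nabla F\in\mathbb{R}^m$ in the formulas; $L_gF(x)u$ denotes the inner product. CLF: given an open set $\mathcal{D}\subseteq\mathbb{R}^n$ with $0\in\mathcal{D}$, a continuously differentiable $V:\mathbb{R}^n\to\mathbb{R}$ is a control Lyapunov function (CLF) on $\mathcal{D}$ if (a) $V$ is proper in $\mathcal{D}$, i.e., $\{x\in\mathcal{D}:V(x)\le c\}$ is compact for all $c>0$; (b) $V$ is positive definite ($V(0)=0$, $V(x)>0$ for $x\ne0$); (c) there is a continuous positive definite function $W:\mathbb{R}^n\to\mathbb{R}$ such that for each $x\in\mathcal{D}\setminus\{0\}$ there is $u\in\mathbb{R}^m$ with $L_fV(x)+L_gV(x)u\le -W(x)$. CBF: a continuously differentiable $h:\mathbb{R}^n\to\mathbb{R}$ with $\mathcal{C}=\{x\in\mathbb{R}^n:h(x)\ge0\}$ is a control barrier function (CBF) of $\mathcal{C}$ if there is a class $\mathcal{K}_\infty$ function $\alpha$ ($\alpha:\mathbb{R}\to\mathbb{R}$, $\alpha(0)=0$, strictly increasing, $\alpha(t)\to\infty$ as $t\to\infty$) such that for all $x\in\mathcal{C}$ there is $u\in\mathbb{R}^m$ with $L_fh(x)+L_gh(x)u+\alpha(h(x))\ge0$. Standing assumptions: the functions $L_fV+W$, $L_gV$, $L_fh+\alpha\circ h$, $L_gh$ are Lipschitz, and there is a neighborhood $\bar{\mathcal{C}}$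 of $\mathcal{C}$ such that, for every $x\in\bar{\mathcal{C}}$, each of the inequalities $L_fV(x)+L_gV(x)u\le -W(x)$ and $L_fh(x)+L_gh(x)u+\alpha(h(x))\ge0$ is individually satisfied by some $u\in\mathbb{R}^m$. Controller: for $\epsilon>0$, $$u_\epsilon^{\mathrm{safe}}(x):=\arg\min_{u\in\mathbb{R}^m}\ \tfrac12\|u\|^2+\tfrac1\epsilon\big(L_fV(x)+W(x)+L_gV(x)u\big)\quad\text{s.t.}\quad L_fh(x)+L_gh(x)u+\alpha(h(x))\ge0.$$ The condition $e(x)>0$ implies $L_gh(x)\neq0$. The quantities $N_2$ and $N_4$ depend on $\epsilon$ through $e$.
   Formalization: In (i), the neighborhood of P_g is required to be sufficiently small (inside some fixed neighborhood of P_g that does not depend on the neighborhood of the origin or on ε), because (i) fails for arbitrary neighborhoods of P_g. *)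

theory Defs
  imports "HOL-Analysis.Analysis"
begin

definition grad :: "('a::real_inner \<Rightarrow> real) \<Rightarrow> 'a \<Rightarrow> 'a" where
  "grad F x = (THE D. GDERIV F x :> D)"

definition continuously_differentiable :: "('a::real_inner \<Rightarrow> real) \<Rightarrow> bool" where
  "continuously_differentiable F \<longleftrightarrow>
     (\<exists>G. (\<forall>x. GDERIV F x :> G x) \<and> continuous_on UNIV G)"

definition Lie_f :: "(real^'n \<Rightarrow> real^'n) \<Rightarrow> (real^'n \<Rightarrow> real) \<Rightarrow> real^'n \<Rightarrow> real" where
  "Lie_f f F x = grad F x \<bullet> f x"

(* The input matrix field g takes values in the n x m matrices, real^'m^'n.
   The Lie derivative along g is the column vector g^T grad F. *)
definition Lie_g :: "(real^'n \<Rightarrow> real^'m^'n) \<Rightarrow> (real^'n \<Rightarrow> real) \<Rightarrow> real^'n \<Rightarrow> real^'m" where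
  "Lie_g g F x = transpose (g x) *v grad F x"

(* The library's local_lipschitz is for time-dependent maps; here the time argument is a dummy. *)
definition locally_Lipschitz :: "('a::metric_space \<Rightarrow> 'b::metric_space) \<Rightarrow> bool" where
  "locally_Lipschitz F \<longleftrightarrow> local_lipschitz (UNIV :: real set) UNIV (\<lambda>_. F)"

definition Lipschitz :: "('a::metric_space \<Rightarrow> 'b::metric_space) \<Rightarrow> bool" where
  "Lipschitz F \<longleftrightarrow> (\<exists>L. L-lipschitz_on UNIV F)"

definition neighborhood_of :: "'a::topological_space set \<Rightarrow> 'a set \<Rightarrow> bool" where
  "neighborhood_of U S \<longleftrightarrow> (\<exists>T. open T \<and> S \<subseteq> T \<and> T \<subseteq> U)"

definition proper_in :: "('a::topological_space \<Rightarrow> real) \<Rightarrow> 'a set \<Rightarrow> bool" where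
  "proper_in V D \<longleftrightarrow> (\<forall>c>0. compact {x\<in>D. V x \<le> c})"

definition positive_definite :: "('a::zero \<Rightarrow> real) \<Rightarrow> bool" where
  "positive_definite V \<longleftrightarrow> V 0 = 0 \<and> (\<forall>x. x \<noteq> 0 \<longrightarrow> V x > 0)"

definition CLF_ineq where
  "CLF_ineq f g V W x u \<longleftrightarrow> Lie_f f V x + Lie_g g V x \<bullet> u \<le> - W x"

definition CBF_ineq where
  "CBF_ineq f g h \<alpha> x u \<longleftrightarrow> Lie_f f h x + Lie_g g h x \<bullet> u + \<alpha> (h x) \<ge> (0::real)"

(* Control Lyapunov function on D, with the associated function W as a parameter. *)
definition CLF_with ::
  "(real^'n \<Rightarrow> real^'n) \<Rightarrow> (real^'n \<Rightarrow> real^'m^'n) \<Rightarrow> (real^'n) set \<Rightarrow>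
   (real^'n \<Rightarrow> real) \<Rightarrow> (real^'n \<Rightarrow> real) \<Rightarrow> bool" where
  "CLF_with f g D V W \<longleftrightarrow>
     open D \<and> 0 \<in> D \<and> continuously_differentiable V \<and>
     proper_in V D \<and> positive_definite V \<and>
     continuous_on UNIV W \<and> positive_definite W \<and>
     (\<forall>x\<in>D - {0}. \<exists>u. CLF_ineq f g V W x u)"

definition class_K_inf :: "(real \<Rightarrow> real) \<Rightarrow> bool" where
  "class_K_inf \<alpha> \<longleftrightarrow> \<alpha> 0 = 0 \<and> strict_mono \<alpha> \<and> filterlim \<alpha> at_top at_top"

(* Control barrier function of C, with the associated function \<alpha> as a parameter. *)
definition CBF_with ::
  "(real^'n \<Rightarrow> real^'n) \<Rightarrow> (real^'n \<Rightarrow> real^'m^'n) \<Rightarrow> (real^'n) set \<Rightarrow>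
   (real^'n \<Rightarrow> real) \<Rightarrow> (real \<Rightarrow> real) \<Rightarrow> bool" where
  "CBF_with f g C h \<alpha> \<longleftrightarrow>
     continuously_differentiable h \<and> C = {x. h x \<ge> 0} \<and> class_K_inf \<alpha> \<and>
     (\<forall>x\<in>C. \<exists>u. CBF_ineq f g h \<alpha> x u)"

definition u_safe ::
  "(real^'n \<Rightarrow> real^'n) \<Rightarrow> (real^'n \<Rightarrow> real^'m^'n) \<Rightarrow> (real^'n \<Rightarrow> real) \<Rightarrow> (real^'n \<Rightarrow> real) \<Rightarrow>
   (real^'n \<Rightarrow> real) \<Rightarrow> (real \<Rightarrow> real) \<Rightarrow> real \<Rightarrow> real^'n \<Rightarrow> real^'m" where
  "u_safe f g V W h \<alpha> \<epsilon> x =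
     (ARG_MIN (\<lambda>u. 1/2 * (norm u)\<^sup>2 + 1/\<epsilon> * (Lie_f f V x + W x + Lie_g g V x \<bullet> u)) u.
        CBF_ineq f g h \<alpha> x u)"

definition closed_loop ::
  "(real^'n \<Rightarrow> real^'n) \<Rightarrow> (real^'n \<Rightarrow> real^'m^'n) \<Rightarrow> (real^'n \<Rightarrow> real^'m) \<Rightarrow> real^'n \<Rightarrow> real^'n" where
  "closed_loop f g k x = f x + g x *v k x"

definition equilibria :: "(real^'n \<Rightarrow> real^'n) \<Rightarrow> (real^'n) set" where
  "equilibria F = {x. F x = 0}"

definition e_fun ::
  "(real^'n \<Rightarrow> real^'n) \<Rightarrow> (real^'n \<Rightarrow> real^'m^'n) \<Rightarrow> (real^'n \<Rightarrow> real) \<Rightarrow>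
   (real^'n \<Rightarrow> real) \<Rightarrow> (real \<Rightarrow> real) \<Rightarrow> real \<Rightarrow> real^'n \<Rightarrow> real" where
  "e_fun f g V h \<alpha> \<epsilon> x =
     - Lie_f f h x + 1/\<epsilon> * (Lie_g g h x \<bullet> Lie_g g V x) - \<alpha> (h x)"

(* drift_bdry and gLV_bdry are the two vectors balanced at boundary equilibria:
   f and g L_gV, corrected by multiples of g L_gh. *)
definition drift_bdry ::
  "(real^'n \<Rightarrow> real^'n) \<Rightarrow> (real^'n \<Rightarrow> real^'m^'n) \<Rightarrow> (real^'n \<Rightarrow> real) \<Rightarrow> real^'n \<Rightarrow> real^'n" where
  "drift_bdry f g h x =
     f x - (Lie_f f h x / (norm (Lie_g g h x))\<^sup>2) *\<^sub>R (g x *v Lie_g g h x)"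

definition gLV_bdry ::
  "(real^'n \<Rightarrow> real^'m^'n) \<Rightarrow> (real^'n \<Rightarrow> real) \<Rightarrow> (real^'n \<Rightarrow> real) \<Rightarrow> real^'n \<Rightarrow> real^'n" where
  "gLV_bdry g V h x =
     g x *v (Lie_g g V x -
       ((Lie_g g h x \<bullet> Lie_g g V x) / (norm (Lie_g g h x))\<^sup>2) *\<^sub>R Lie_g g h x)"

definition Q1 where
  "Q1 f g V h \<alpha> C \<epsilon> =
     {x\<in>C. e_fun f g V h \<alpha> \<epsilon> x \<le> 0 \<and> f x = (1/\<epsilon>) *\<^sub>R (g x *v Lie_g g V x)}"

definition Q2 where
  "Q2 f g V h \<alpha> C \<epsilon> =
     {x\<in>frontier C. e_fun f g V h \<alpha> \<epsilon> x > 0 \<and>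
        f x = (Lie_f f h x / (norm (Lie_g g h x))\<^sup>2) *\<^sub>R (g x *v Lie_g g h x)
              + (1/\<epsilon>) *\<^sub>R gLV_bdry g V h x}"

definition P_g where
  "P_g g V C = {x\<in>C - {0}. Lie_g g V x = 0}"

(* The suprema and infima of norms are taken in [0,\<infinity>]: over the empty set the supremum is 0
   and the infimum is \<infinity>.  In quotients of such values, a / 0 = \<infinity> for a > 0 and 0 / 0 = 0. *)
definition N1 :: "(real^'n \<Rightarrow> real^'n) \<Rightarrow> (real^'n) set \<Rightarrow> ennreal" where
  "N1 f C = (SUP x\<in>C. ennreal (norm (f x)))"

definition N2 ::
  "(real^'n \<Rightarrow> real^'n) \<Rightarrow> (real^'n \<Rightarrow> real^'m^'n) \<Rightarrow> (real^'n \<Rightarrow> real) \<Rightarrow>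
   (real^'n \<Rightarrow> real) \<Rightarrow> (real \<Rightarrow> real) \<Rightarrow> (real^'n) set \<Rightarrow> real \<Rightarrow> ennreal" where
  "N2 f g V h \<alpha> C \<epsilon> =
     (SUP x\<in>{x\<in>frontier C. e_fun f g V h \<alpha> \<epsilon> x > 0}. ennreal (norm (drift_bdry f g h x)))"

definition N3 ::
  "(real^'n \<Rightarrow> real^'m^'n) \<Rightarrow> (real^'n \<Rightarrow> real) \<Rightarrow> (real^'n) set \<Rightarrow>
   (real^'n) set \<Rightarrow> (real^'n) set \<Rightarrow> ennreal" where
  "N3 g V C U Ubar = (INF x\<in>C - (U \<union> Ubar). ennreal (norm (g x *v Lie_g g V x)))"

definition N4 ::
  "(real^'n \<Rightarrow> real^'n) \<Rightarrow> (real^'n \<Rightarrow> real^'m^'n) \<Rightarrow> (real^'n \<Rightarrow> real) \<Rightarrow>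
   (real^'n \<Rightarrow> real) \<Rightarrow> (real \<Rightarrow> real) \<Rightarrow> (real^'n) set \<Rightarrow> real \<Rightarrow> ennreal" where
  "N4 f g V h \<alpha> C \<epsilon> =
     (INF x\<in>{x\<in>frontier C. e_fun f g V h \<alpha> \<epsilon> x > 0}. ennreal (norm (gLV_bdry g V h x)))"

end

theory Submission
  imports Defs
begin

text \<open>
  Up to an additive constant and the change of variable \<open>v = u + L\<^sub>gV/\<epsilon>\<close>, the quadratic program
  minimises \<open>\<parallel>v\<parallel>\<close> over a half-space, so its solution is the explicit projection: \<open>-L\<^sub>gV/\<epsilon>\<close> if
  \<open>e \<le> 0\<close>, and that vector plus \<open>(e/\<parallel>L\<^sub>gh\<parallel>\<^sup>2) L\<^sub>gh\<close> if \<open>e > 0\<close>.  In the second case the constraint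
  is active, so at an equilibrium \<open>0 = \<nabla>h \<bullet> (f + g u) = -\<alpha>(h)\<close>; hence \<open>h = 0\<close>, and since
  \<open>L\<^sub>gh \<noteq> 0\<close> forces \<open>\<nabla>h \<noteq> 0\<close>, the equilibrium lies on the boundary.  For (i), points of
  \<open>P\<^sub>g\<close> satisfy \<open>L\<^sub>fV \<le> -W < 0\<close>, whereas points of \<open>Q\<^sub>1\<close> satisfy
  \<open>L\<^sub>fV = \<parallel>L\<^sub>gV\<parallel>\<^sup>2/\<epsilon> \<ge> 0\<close>; so \<open>{L\<^sub>fV < 0}\<close> is a neighborhood of \<open>P\<^sub>g\<close> that contains no point
  of \<open>Q\<^sub>1\<close>, for every \<open>\<epsilon>\<close>.
\<close>

section \<open>Gradients, continuity and Lie derivatives\<close>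

lemma grad_eqI:
  assumes "GDERIV F x :> D"
  shows "grad F x = D"
  unfolding grad_def
proof (rule the_equality)
  fix D' assume "GDERIV F x :> D'"
  then have "(\<lambda>v. v \<bullet> D') = (\<lambda>v. v \<bullet> D)"
    using assms unfolding gderiv_def by (rule has_derivative_unique)
  then have "v \<bullet> D' = v \<bullet> D" for v
    by (rule fun_cong)
  then show "D' = D"
    by (metis vector_eq_ldot)
qed (fact assms)

lemma continuously_differentiable_grad:
  assumes "continuously_differentiable F"
  shows "GDERIV F x :> grad F x" and "continuous_on UNIV (grad F)"
proof -
  obtain G where G: "\<And>x. GDERIV F x :> G x" "continuous_on UNIV G"
    using assms unfolding continuously_differentiable_def by blast
  have "grad F = G"
    by (intro ext grad_eqI G)
  then show "GDERIV F x :> grad F x" "continuous_on UNIV (grad F)"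
    using G by auto
qed

lemma continuously_differentiable_continuous_on:
  assumes "continuously_differentiable F"
  shows "continuous_on S F"
  using continuously_differentiable_grad(1)[OF assms]
  by (meson continuous_at_imp_continuous_on gderiv_def has_derivative_continuous)

text \<open>Needed for \<open>V\<close> at the origin, its global minimum, and for \<open>h\<close>
  at a zero interior to its superlevel set.\<close>

lemma grad_local_min:
  assumes "continuously_differentiable F" and "eventually (\<lambda>y. F x \<le> F y) (at x)"
  shows "grad F x = 0"
proof -
  have "(F has_derivative (\<lambda>v. v \<bullet> grad F x)) (at x)"
    using continuously_differentiable_grad(1)[OF assms(1)] by (simp add: gderiv_def)
  from has_derivative_local_min[OF this assms(2)] have "(\<lambda>v. v \<bullet> grad F x) = (\<lambda>v. 0)" .
  then have "grad F x \<bullet> grad F x = 0"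
    by (rule fun_cong)
  then show ?thesis
    by simp
qed

lemma locally_Lipschitz_continuous_on:
  assumes "locally_Lipschitz F"
  shows "continuous_on UNIV F"
  using local_lipschitz_continuous_on[OF assms[unfolded locally_Lipschitz_def]] by simp

lemma Lie_g_inner: "Lie_g g F x \<bullet> u = grad F x \<bullet> (g x *v u)"
  by (simp add: Lie_g_def dot_lmul_matrix)

section \<open>Explicit solution of the quadratic program\<close>

lemma arg_min_unique:
  fixes F :: "'a \<Rightarrow> 'b::order"
  assumes "P p" and "\<And>u. P u \<Longrightarrow> u \<noteq> p \<Longrightarrow> F p < F u"
  shows "arg_min F P = p"
  using assms by (intro arg_minI[where Q = "\<lambda>u. u = p" and x = p]) (auto dest: less_asym)

text \<open>Completing the square around \<open>p\<close>: the objective exceeds its value at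
  \<open>p\<close> by half of the squared distance plus \<open>(p + c) \<bullet> (u - p)\<close>,
  where \<open>p + c\<close> is the gradient at \<open>p\<close>. The square makes the minimum
  strict, which determines the value chosen by \<open>arg_min\<close>.\<close>

lemma arg_min_quadratic:
  fixes c p :: "'a::real_inner"
  assumes "P p" and var: "\<And>u. P u \<Longrightarrow> (p + c) \<bullet> (u - p) \<ge> 0"
  shows "arg_min (\<lambda>u. 1/2 * (norm u)\<^sup>2 + (k + c \<bullet> u)) P = p"
proof (rule arg_min_unique)
  fix u assume "P u" "u \<noteq> p"
  then have "(norm (u - p))\<^sup>2 > 0" "(p + c) \<bullet> (u - p) \<ge> 0"
    using var by auto
  moreover have "1/2 * (norm u)\<^sup>2 + (k + c \<bullet> u)
      = 1/2 * (norm p)\<^sup>2 + (k + c \<bullet> p) + 1/2 * (norm (u - p))\<^sup>2 + (p + c) \<bullet> (u - p)"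
    by (simp add: power2_norm_eq_inner algebra_simps inner_commute)
  ultimately show "1/2 * (norm p)\<^sup>2 + (k + c \<bullet> p) < 1/2 * (norm u)\<^sup>2 + (k + c \<bullet> u)"
    by linarith
qed (fact assms(1))

lemma u_safe_eqI:
  assumes "CBF_ineq f g h \<alpha> x p"
    and "\<And>u. CBF_ineq f g h \<alpha> x u \<Longrightarrow> (p + (1/\<epsilon>) *\<^sub>R Lie_g g V x) \<bullet> (u - p) \<ge> 0"
  shows "u_safe f g V W h \<alpha> \<epsilon> x = p"
  using arg_min_quadratic[where P = "CBF_ineq f g h \<alpha> x", OF assms, where k = "1/\<epsilon> * (Lie_f f V x + W x)"]
  unfolding u_safe_def by (simp add: distrib_left)

text \<open>The number e is minus the slack of the constraint at the unconstrained minimiser, so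
  that point is feasible, and the gradient of the objective vanishes there.\<close>

lemma u_safe_inactive:
  assumes "e_fun f g V h \<alpha> \<epsilon> x \<le> 0"
  shows "u_safe f g V W h \<alpha> \<epsilon> x = (- (1/\<epsilon>)) *\<^sub>R Lie_g g V x"
  using assms by (intro u_safe_eqI) (simp_all add: CBF_ineq_def e_fun_def)

text \<open>If \<open>Lie_g g h x\<close> were zero, e would be minus the left side of the feasible
  inequality, hence nonpositive.\<close>

lemma e_fun_pos_Lie_g_nonzero:
  assumes "e_fun f g V h \<alpha> \<epsilon> x > 0" and "CBF_ineq f g h \<alpha> x u"
  shows "Lie_g g h x \<noteq> 0"
  using assms by (auto simp: e_fun_def CBF_ineq_def)

text \<open>The coefficient of \<open>Lie_g g h x\<close> is the one that makes the constraint an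
  equality. The gradient of the objective at \<open>p\<close> is then a positive multiple of
  \<open>Lie_g g h x\<close>, the inward normal of the feasible half-space.\<close>

lemma u_safe_active:
  fixes g :: "real^'n \<Rightarrow> real^'m^'n"
  assumes e: "e_fun f g V h \<alpha> \<epsilon> x > 0" and b: "Lie_g g h x \<noteq> 0"
  defines "p \<equiv> (e_fun f g V h \<alpha> \<epsilon> x / (norm (Lie_g g h x))\<^sup>2) *\<^sub>R Lie_g g h x
                 - (1/\<epsilon>) *\<^sub>R Lie_g g V x"
  shows "u_safe f g V W h \<alpha> \<epsilon> x = p"
    and "Lie_f f h x + Lie_g g h x \<bullet> p + \<alpha> (h x) = 0"
proof -
  have "Lie_g g h x \<bullet> p = e_fun f g V h \<alpha> \<epsilon> x - 1/\<epsilon> * (Lie_g g h x \<bullet> Lie_g g V x)"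
    using b by (simp add: p_def inner_diff_right power2_norm_eq_inner)
  then show active: "Lie_f f h x + Lie_g g h x \<bullet> p + \<alpha> (h x) = 0"
    by (simp add: e_fun_def)
  show "u_safe f g V W h \<alpha> \<epsilon> x = p"
  proof (rule u_safe_eqI)
    show "CBF_ineq f g h \<alpha> x p"
      using active by (simp add: CBF_ineq_def)
    fix u assume "CBF_ineq f g h \<alpha> x u"
    then have "Lie_g g h x \<bullet> (u - p) \<ge> 0"
      using active by (simp add: CBF_ineq_def inner_diff_right)
    then show "(p + (1/\<epsilon>) *\<^sub>R Lie_g g V x) \<bullet> (u - p) \<ge> 0"
      using e by (simp add: p_def)
  qed
qed

section \<open>The boundary of the safe set and the zeros of \<open>h\<close>\<close>

lemma class_K_inf_eq_0_iff:
  assumes "class_K_inf \<alpha>"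
  shows "\<alpha> t = 0 \<longleftrightarrow> t = 0"
  using assms unfolding class_K_inf_def by (metis strict_mono_eq)

text \<open>Closedness of the superlevel set rules out \<open>h x < 0\<close>; openness of the set
  where \<open>h\<close> is positive puts it in the interior and rules out
  \<open>h x > 0\<close>.\<close>

lemma frontier_superlevel_eq_0:
  fixes h :: "'a::topological_space \<Rightarrow> real"
  assumes "continuous_on UNIV h" and "x \<in> frontier {x. h x \<ge> 0}"
  shows "h x = 0"
proof -
  have "closed {x. h x \<ge> 0}" and "open {x. h x > 0}"
    using assms(1) by (auto intro: closed_Collect_le open_Collect_less continuous_on_const)
  moreover from this(2) have "{x. h x > 0} \<subseteq> interior {x. h x \<ge> 0}"
    by (intro interior_maximal) auto
  ultimately show ?thesis
    using assms(2) by (force simp: frontier_def)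
qed

text \<open>A zero of \<open>h\<close> in the interior would be a local minimum, forcing the
  gradient to vanish.\<close>

lemma zero_in_frontier_superlevel:
  assumes "continuously_differentiable h" and "h x = 0" and "grad h x \<noteq> 0"
  shows "x \<in> frontier {x. h x \<ge> 0}"
proof -
  have "x \<notin> interior {x. h x \<ge> 0}"
  proof
    assume "x \<in> interior {x. h x \<ge> 0}"
    then have "eventually (\<lambda>y. y \<in> interior {x. h x \<ge> 0}) (at x)"
      by (intro eventually_at_topological[THEN iffD2]) blast
    then have "eventually (\<lambda>y. h x \<le> h y) (at x)"
      by eventually_elim (use assms(2) interior_subset in fastforce)
    then show False
      using grad_local_min assms by blast
  qed
  then show ?thesis
    using assms(2) closure_subset by (fastforce simp: frontier_def)
qed

section \<open>Excluding equilibria for small \<epsilon>\<close>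

text \<open>Common core of (i) and (ii): \<open>s\<close> and \<open>r\<close> are the norms of the
  two vectors balanced at an equilibrium, so \<open>N\<close> \<le> \<open>s\<close> = \<epsilon>
  \<open>r\<close> \<le> \<epsilon> \<open>M\<close>.\<close>

lemma ennreal_quotient_bound_contradiction:
  assumes "ennreal \<epsilon> < N / M" and "M < \<infinity>" and "\<epsilon> > 0"
    and "N \<le> ennreal s" and "ennreal r \<le> M" and "r = (1/\<epsilon>) * s"
  shows False
proof (cases "M = 0")
  \<comment> \<open>Here \<open>N\<close> is forced to be 0 as well, and the convention 0 / 0 = 0
    contradicts the strict bound on \<epsilon>.\<close>
  case True
  then have "r \<le> 0"
    using assms(5) by (simp add: ennreal_eq_0_iff)
  then have "s \<le> 0"
    using assms(3,6) by (simp add: divide_le_0_iff)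
  then have "N = 0"
    using assms(4) by (simp add: ennreal_neg)
  then show False
    using assms(1) by simp
next
  case False
  have "ennreal s = ennreal \<epsilon> * ennreal r"
    using assms(3,6) by (simp flip: ennreal_mult')
  also have "\<dots> \<le> ennreal \<epsilon> * M"
    using assms(5) by (rule mult_left_mono) simp
  finally have "N / M \<le> ennreal \<epsilon> * M / M"
    using assms(4) by (intro divide_right_mono_ennreal) (rule order_trans)
  also have "\<dots> = ennreal \<epsilon>"
    using False assms(2) by (simp add: ennreal_mult_divide_eq)
  finally show False
    using assms(1) by simp
qed

text \<open>Pair the equation defining \<open>Q1\<close> with the gradient of
  \<open>V\<close>.\<close>

lemma Q1_Lie_f_nonneg:
  assumes "x \<in> Q1 f g V h \<alpha> C \<epsilon>" and "\<epsilon> > 0"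
  shows "Lie_f f V x \<ge> 0"
proof -
  have "f x = (1/\<epsilon>) *\<^sub>R (g x *v Lie_g g V x)"
    using assms(1) by (simp add: Q1_def)
  then have "Lie_f f V x = (1/\<epsilon>) * (Lie_g g V x \<bullet> Lie_g g V x)"
    by (simp add: Lie_f_def Lie_g_inner)
  then show ?thesis
    using assms(2) by simp
qed

text \<open>The condition on \<open>Ubar\<close> keeps points of \<open>Q1\<close> out of it, so
  that one outside \<open>U\<close> is seen by the infimum \<open>N3\<close>.\<close>

lemma Q1_subset:
  fixes g :: "real^'n \<Rightarrow> real^'m^'n"
  assumes "\<And>x. x \<in> Ubar \<Longrightarrow> Lie_f f V x < 0" and "N1 f C < \<infinity>" and "\<epsilon> > 0"
    and "ennreal \<epsilon> < N3 g V C U Ubar / N1 f C"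
  shows "Q1 f g V h \<alpha> C \<epsilon> \<subseteq> U"
proof (rule subsetI, rule ccontr)
  fix x assume x: "x \<in> Q1 f g V h \<alpha> C \<epsilon>" and "x \<notin> U"
  then have "x \<in> C - (U \<union> Ubar)"
    using Q1_Lie_f_nonneg[OF x \<open>\<epsilon> > 0\<close>] assms(1) by (force simp: Q1_def)
  then have "N3 g V C U Ubar \<le> ennreal (norm (g x *v Lie_g g V x))"
    and "ennreal (norm (f x)) \<le> N1 f C"
    unfolding N3_def N1_def by (auto intro: INF_lower SUP_upper)
  moreover have "norm (f x) = (1/\<epsilon>) * norm (g x *v Lie_g g V x)"
    using x \<open>\<epsilon> > 0\<close> by (simp add: Q1_def)
  ultimately show False
    using ennreal_quotient_bound_contradiction assms(2-4) by blast
qed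

lemma Q2_empty:
  fixes g :: "real^'n \<Rightarrow> real^'m^'n"
  assumes "N2 f g V h \<alpha> C \<epsilon> < \<infinity>" and "\<epsilon> > 0"
    and "ennreal \<epsilon> < N4 f g V h \<alpha> C \<epsilon> / N2 f g V h \<alpha> C \<epsilon>"
  shows "Q2 f g V h \<alpha> C \<epsilon> = {}"
proof (rule ccontr)
  assume "Q2 f g V h \<alpha> C \<epsilon> \<noteq> {}"
  then obtain x where x: "x \<in> Q2 f g V h \<alpha> C \<epsilon>"
    by blast
  then have "N4 f g V h \<alpha> C \<epsilon> \<le> ennreal (norm (gLV_bdry g V h x))"
    and "ennreal (norm (drift_bdry f g h x)) \<le> N2 f g V h \<alpha> C \<epsilon>"
    unfolding N4_def N2_def by (auto simp: Q2_def intro!: INF_lower SUP_upper)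
  \<comment> \<open>Moving the \<open>Lie_f f h x\<close> term to the left gives the equation of
    \<open>Q2\<close> the same proportional form as that of \<open>Q1\<close>.\<close>
  moreover have "drift_bdry f g h x = (1/\<epsilon>) *\<^sub>R gLV_bdry g V h x"
    using x unfolding Q2_def drift_bdry_def by (simp add: algebra_simps)
  then have "norm (drift_bdry f g h x) = (1/\<epsilon>) * norm (gLV_bdry g V h x)"
    using \<open>\<epsilon> > 0\<close> by simp
  ultimately show False
    using ennreal_quotient_bound_contradiction assms by blast
qed

section \<open>The equilibrium set and the final assembly\<close>

text \<open>With \<alpha>(h) = 0, the multiplier e / |L_gh|^2 splits into a part that projects L_gV
  off L_gh and a part that carries L_fh.\<close>

lemma closed_loop_active_zero_iff:
  fixes g :: "real^'n \<Rightarrow> real^'m^'n"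
  assumes e: "e_fun f g V h \<alpha> \<epsilon> x > 0" and b: "Lie_g g h x \<noteq> 0" and "\<alpha> (h x) = 0"
  shows "closed_loop f g (u_safe f g V W h \<alpha> \<epsilon>) x = 0 \<longleftrightarrow>
    f x = (Lie_f f h x / (norm (Lie_g g h x))\<^sup>2) *\<^sub>R (g x *v Lie_g g h x)
          + (1/\<epsilon>) *\<^sub>R gLV_bdry g V h x"
proof -
  have "e_fun f g V h \<alpha> \<epsilon> x / (norm (Lie_g g h x))\<^sup>2 =
      1/\<epsilon> * ((Lie_g g h x \<bullet> Lie_g g V x) / (norm (Lie_g g h x))\<^sup>2)
      - Lie_f f h x / (norm (Lie_g g h x))\<^sup>2"
    using assms(3) by (simp add: e_fun_def diff_divide_distrib)
  then have "closed_loop f g (u_safe f g V W h \<alpha> \<epsilon>) x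
      = f x - ((Lie_f f h x / (norm (Lie_g g h x))\<^sup>2) *\<^sub>R (g x *v Lie_g g h x)
               + (1/\<epsilon>) *\<^sub>R gLV_bdry g V h x)"
    unfolding closed_loop_def u_safe_active(1)[OF e b] gLV_bdry_def
    by (simp add: matrix_vector_mult_diff_distrib matrix_vector_mult_scaleR
        scaleR_diff_left scaleR_diff_right)
  then show ?thesis
    by simp
qed

lemma equilibria_eq:
  fixes g :: "real^'n \<Rightarrow> real^'m^'n"
  assumes "CBF_with f g C h \<alpha>"
  shows "C \<inter> equilibria (closed_loop f g (u_safe f g V W h \<alpha> \<epsilon>))
    = Q1 f g V h \<alpha> C \<epsilon> \<union> Q2 f g V h \<alpha> C \<epsilon>"
proof -
  have h: "continuously_differentiable h" and C: "C = {x. h x \<ge> 0}" and "class_K_inf \<alpha>"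
    and feas: "\<And>x. x \<in> C \<Longrightarrow> \<exists>u. CBF_ineq f g h \<alpha> x u"
    using assms unfolding CBF_with_def by blast+
  note \<alpha>0 = class_K_inf_eq_0_iff[OF \<open>class_K_inf \<alpha>\<close>]
  have frontier: "h x = 0" "x \<in> C" if "x \<in> frontier C" for x
  proof -
    show "h x = 0"
      using frontier_superlevel_eq_0[OF continuously_differentiable_continuous_on[OF h]] that
      unfolding C .
    then show "x \<in> C"
      by (simp add: C)
  qed
  let ?F = "closed_loop f g (u_safe f g V W h \<alpha> \<epsilon>)"
  have "x \<in> C \<and> ?F x = 0 \<longleftrightarrow> x \<in> Q1 f g V h \<alpha> C \<epsilon> \<union> Q2 f g V h \<alpha> C \<epsilon>" for x
  proof (cases "e_fun f g V h \<alpha> \<epsilon> x \<le> 0")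
    case True
    then have "?F x = f x - (1/\<epsilon>) *\<^sub>R (g x *v Lie_g g V x)"
      unfolding closed_loop_def u_safe_inactive[OF True] matrix_vector_mult_scaleR by simp
    then show ?thesis
      using True by (auto simp: Q1_def Q2_def)
  next
    case False
    then have e: "e_fun f g V h \<alpha> \<epsilon> x > 0"
      by simp
    have b: "Lie_g g h x \<noteq> 0" if "x \<in> C"
      using e_fun_pos_Lie_g_nonzero[OF e] feas[OF that] by blast
    have "x \<in> frontier C" if "x \<in> C" "?F x = 0"
    proof -
      have "0 = grad h x \<bullet> ?F x"
        using that by simp
      also have "\<dots> = Lie_f f h x + Lie_g g h x \<bullet> u_safe f g V W h \<alpha> \<epsilon> x"
        by (simp add: closed_loop_def inner_add_right Lie_f_def Lie_g_inner)
      also have "\<dots> = - \<alpha> (h x)"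
        using u_safe_active[OF e b[OF \<open>x \<in> C\<close>]] by simp
      finally have "h x = 0"
        using \<alpha>0 by simp
      moreover have "grad h x \<noteq> 0"
        using b[OF \<open>x \<in> C\<close>] by (auto simp: Lie_g_def)
      ultimately show ?thesis
        using zero_in_frontier_superlevel[OF h] C by simp
    qed
    then have "x \<in> C \<and> ?F x = 0 \<longleftrightarrow> x \<in> frontier C \<and> ?F x = 0"
      using frontier by blast
    also have "\<dots> \<longleftrightarrow> x \<in> Q2 f g V h \<alpha> C \<epsilon>"
      using closed_loop_active_zero_iff[OF e b] frontier \<alpha>0 e by (auto simp: Q2_def)
    finally show ?thesis
      using e by (auto simp: Q1_def)
  qed
  then show ?thesis
    by (auto simp: equilibria_def)
qed

text \<open>The origin minimises \<open>V\<close>, so L_gV vanishes there, and so does L_fh because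
  \<open>f 0 = 0\<close>. What remains of e is -\<alpha>(h(0)), nonpositive by monotonicity of
  \<alpha>.\<close>

lemma zero_in_Q1:
  assumes "f 0 = 0" and "0 \<in> C" and V: "CLF_with f g D V W" and h: "CBF_with f g C h \<alpha>"
  shows "0 \<in> Q1 f g V h \<alpha> C \<epsilon>"
proof -
  have "V 0 \<le> V y" for y
    using V by (cases "y = 0") (auto simp: CLF_with_def positive_definite_def less_imp_le)
  then have "grad V 0 = 0"
    using V by (intro grad_local_min) (auto simp: CLF_with_def)
  then have "Lie_g g V 0 = 0"
    by (simp add: Lie_g_def)
  moreover have "\<alpha> (h 0) \<ge> 0"
    using h \<open>0 \<in> C\<close> unfolding CBF_with_def class_K_inf_def
    by (metis mem_Collect_eq strict_mono_less_eq)
  ultimately show ?thesis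
    using assms(1,2) by (simp add: Q1_def e_fun_def Lie_f_def)
qed

text \<open>Openness comes from continuity of \<open>f\<close> and of the gradient of
  \<open>V\<close>; on \<open>P_g\<close> the control term of the CLF inequality vanishes.\<close>

lemma Lie_f_neg_neighborhood:
  assumes f: "locally_Lipschitz f" and "C \<subseteq> D" and V: "CLF_with f g D V W"
  shows "neighborhood_of {x. Lie_f f V x < 0} (P_g g V C)"
proof -
  have "continuous_on UNIV (grad V)"
    using V by (intro continuously_differentiable_grad(2)) (simp add: CLF_with_def)
  then have "open {x. Lie_f f V x < 0}"
    unfolding Lie_f_def using locally_Lipschitz_continuous_on[OF f]
    by (intro open_Collect_less continuous_intros)
  moreover have "P_g g V C \<subseteq> {x. Lie_f f V x < 0}"
  proof
    fix x assume "x \<in> P_g g V C"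
    then have "x \<in> D - {0}" "Lie_g g V x = 0"
      using \<open>C \<subseteq> D\<close> by (auto simp: P_g_def)
    then obtain u where "Lie_f f V x + Lie_g g V x \<bullet> u \<le> - W x" and "W x > 0"
      using V unfolding CLF_with_def CLF_ineq_def positive_definite_def by blast
    then show "x \<in> {x. Lie_f f V x < 0}"
      using \<open>Lie_g g V x = 0\<close> by simp
  qed
  ultimately show ?thesis
    unfolding neighborhood_of_def by blast
qed

theorem proposition5p1:
  fixes f :: "real^'n \<Rightarrow> real^'n"
    and g :: "real^'n \<Rightarrow> real^'m^'n"
    and D C Cbar :: "(real^'n) set"
    and V W h :: "real^'n \<Rightarrow> real"
    and \<alpha> :: "real \<Rightarrow> real"
  assumes "locally_Lipschitz f" and "locally_Lipschitz g" and "f 0 = 0"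
    and "open D" and "C \<subseteq> D" and "closed C" and "0 \<in> C"
    and "CLF_with f g D V W"
    and "CBF_with f g C h \<alpha>"
    and "Lipschitz (\<lambda>x. Lie_f f V x + W x)"
    and "Lipschitz (Lie_g g V)"
    and "Lipschitz (\<lambda>x. Lie_f f h x + \<alpha> (h x))"
    and "Lipschitz (Lie_g g h)"
    and "neighborhood_of Cbar C"
    and "\<forall>x\<in>Cbar. (\<exists>u. CLF_ineq f g V W x u) \<and> (\<exists>u. CBF_ineq f g h \<alpha> x u)"
  shows "(\<forall>\<epsilon>>0.
            C \<inter> equilibria (closed_loop f g (u_safe f g V W h \<alpha> \<epsilon>))
              = Q1 f g V h \<alpha> C \<epsilon> \<union> Q2 f g V h \<alpha> C \<epsilon>
            \<and> 0 \<in> Q1 f g V h \<alpha> C \<epsilon>)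
       \<and> (\<exists>U0. neighborhood_of U0 (P_g g V C) \<and>
            (\<forall>U Ubar. neighborhood_of U {0} \<and> neighborhood_of Ubar (P_g g V C) \<and> Ubar \<subseteq> U0 \<longrightarrow>
               N1 f C < \<infinity> \<longrightarrow>
               (\<forall>\<epsilon>>0. ennreal \<epsilon> < N3 g V C U Ubar / N1 f C \<longrightarrow> Q1 f g V h \<alpha> C \<epsilon> \<subseteq> U)))
       \<and> (\<forall>\<epsilon>>0. N2 f g V h \<alpha> C \<epsilon> < \<infinity> \<and> N4 f g V h \<alpha> C \<epsilon> > 0 \<longrightarrow>
            ennreal \<epsilon> < N4 f g V h \<alpha> C \<epsilon> / N2 f g V h \<alpha> C \<epsilon> \<longrightarrow>
            Q2 f g V h \<alpha> C \<epsilon> = {})"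
proof (intro conjI allI impI)
  fix \<epsilon> :: real
  show "C \<inter> equilibria (closed_loop f g (u_safe f g V W h \<alpha> \<epsilon>))
      = Q1 f g V h \<alpha> C \<epsilon> \<union> Q2 f g V h \<alpha> C \<epsilon>"
    using \<open>CBF_with f g C h \<alpha>\<close> by (rule equilibria_eq)
  show "0 \<in> Q1 f g V h \<alpha> C \<epsilon>"
    using \<open>f 0 = 0\<close> \<open>0 \<in> C\<close> \<open>CLF_with f g D V W\<close> \<open>CBF_with f g C h \<alpha>\<close> by (rule zero_in_Q1)
next
  have "neighborhood_of {x. Lie_f f V x < 0} (P_g g V C)"
    using \<open>locally_Lipschitz f\<close> \<open>C \<subseteq> D\<close> \<open>CLF_with f g D V W\<close> by (rule Lie_f_neg_neighborhood)
  moreover have "Q1 f g V h \<alpha> C \<epsilon> \<subseteq> U"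
    if "Ubar \<subseteq> {x. Lie_f f V x < 0}" "N1 f C < \<infinity>" "\<epsilon> > 0"
      "ennreal \<epsilon> < N3 g V C U Ubar / N1 f C" for U Ubar \<epsilon>
    by (rule Q1_subset[OF _ that(2-4)]) (use that(1) in auto)
  ultimately show "\<exists>U0. neighborhood_of U0 (P_g g V C) \<and>
      (\<forall>U Ubar. neighborhood_of U {0} \<and> neighborhood_of Ubar (P_g g V C) \<and> Ubar \<subseteq> U0 \<longrightarrow>
         N1 f C < \<infinity> \<longrightarrow>
         (\<forall>\<epsilon>>0. ennreal \<epsilon> < N3 g V C U Ubar / N1 f C \<longrightarrow> Q1 f g V h \<alpha> C \<epsilon> \<subseteq> U))"
    by blast
next
  fix \<epsilon> :: real
  assume "\<epsilon> > 0" "N2 f g V h \<alpha> C \<epsilon> < \<infinity> \<and> N4 f g V h \<alpha> C \<epsilon> > 0"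
    "ennreal \<epsilon> < N4 f g V h \<alpha> C \<epsilon> / N2 f g V h \<alpha> C \<epsilon>"
  then show "Q2 f g V h \<alpha> C \<epsilon> = {}"
    by (intro Q2_empty) auto
qed

end
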